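(* Let $q>2$ and $k>t\ge 0$ be integers. Then there is $n_0=n_0(q,k,t)$ such that for all $n\ge n_0$, the set $\mathcal A_q(t,k,n)$ is a maximum size anticode of length $n$, constant weight $k$ and diameter $2(k-t)-1$ over $\mathbb Z_q$; that is, it is an $(n,2(k-t)-1,k)_q$ anticode and every $(n,2(k-t)-1,k)_q$ anticode $\mathcal B$ satisfies $|\mathcal B|\le|\mathcal A_q(t,k,n)|$.
   Context: $\mathbb Z_q=\{0,1,\dots,q-1\}$ is the alphabet. The Hamming distance of two words of the same length over $\mathbb Z_q$ is the number of coordinates in which they differ; the weight $\mathrm{wt}(x)$ of a word $x$ is the number of its nonzero entries. An $(n,D,k)_q$ anticode is a set of words of length $n$ and weight $k$ over $\mathbb Z_q$ whose diameter (the maximum Hamming distance between two of its words) is $D$. $\mathcal A_q(t,k,n)$ is the set of all words of length $n$ over $\mathbb Z_q$ of the form $(1,\dots,1,a,b_1,\dots,b_{n-t-1})$, starting with $t$ ones, where $a\in\mathbb Z_q\setminus\{0\}$, $b_i\in\mathbb Z_q$ and $\mathrm{wt}(b_1,\dots,b_{n-t-1})=k-t-1$. *)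

theory Defs
  imports Main
begin

definition words :: "nat \<Rightarrow> nat \<Rightarrow> nat list set" where
  "words q n = {x. length x = n \<and> set x \<subseteq> {0..<q}}"

(* Only meant for words of equal length. *)
definition hamming_dist :: "nat list \<Rightarrow> nat list \<Rightarrow> nat" where
  "hamming_dist x y = card {i. i < length x \<and> x ! i \<noteq> y ! i}"

definition wt :: "nat list \<Rightarrow> nat" where
  "wt x = card {i. i < length x \<and> x ! i \<noteq> 0}"

(* Only meant for finite nonempty sets of words of equal length; a singleton has diameter 0. *)
definition diameter :: "nat list set \<Rightarrow> nat" where
  "diameter B = Max {hamming_dist x y | x y. x \<in> B \<and> y \<in> B}"

(* The parameters are those of an (n, D, k)_q anticode.  Nonemptiness is required because
   the maximum defining the diameter is taken over a nonempty set. *)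
definition anticode :: "nat \<Rightarrow> nat \<Rightarrow> nat \<Rightarrow> nat \<Rightarrow> nat list set \<Rightarrow> bool" where
  "anticode q n D k B \<longleftrightarrow>
     B \<subseteq> words q n \<and> (\<forall>x\<in>B. wt x = k) \<and> B \<noteq> {} \<and> diameter B = D"

(* The requirement that the whole word has length n forces length b = n - t - 1
   (and makes the set empty if n \<le> t). *)
definition \<A> :: "nat \<Rightarrow> nat \<Rightarrow> nat \<Rightarrow> nat \<Rightarrow> nat list set" where
  "\<A> q t k n =
     {x \<in> words q n. \<exists>a b. x = replicate t 1 @ [a] @ b \<and> a \<noteq> 0 \<and> wt b = k - t - 1}"

end

theory Submission
  imports Defs "HOL-Library.FuncSet"
begin

text \<open>
  For two words of weight \<open>k\<close> whose supports share \<open>c\<close> positions, on \<open>e\<close> of which the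
  letters differ, the Hamming distance is \<open>2 (k - c) + e\<close>. Hence distance at most
  \<open>2 (k - t) - 1\<close> means \<open>2 c \<ge> 2 t + 1 + e\<close>; in particular the supports always share at least
  \<open>t + 1\<close> positions, and if they share exactly \<open>t + 1\<close>, the letters differ on at most one of them.

  For fixed \<open>q, k, t\<close>, the words that have a prescribed pattern of nonzero letters on \<open>t + 1\<close>
  positions number \<open>N = (n - t - 1 choose k - t - 1) (q - 1)^(k - t - 1)\<close>, of order
  \<open>n^(k - t - 1)\<close>, and \<open>\<A> q t k n\<close> consists of \<open>q - 1\<close> disjoint families of this kind. The
  words whose support contains \<open>t + 2\<close> prescribed positions are fewer by a factor of order \<open>n\<close>,
  so any bounded number of such families has at most \<open>N\<close> members altogether once \<open>n\<close> is large
  (\<open>star_bound_negligible\<close>). The size of an arbitrary anticode \<open>B\<close> is bounded in two cases.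

  If no \<open>t + 1\<close> positions lie in all supports, every word of \<open>B\<close> has one of boundedly
  many \<open>(t + 2)\<close>-sets in its support, so \<open>B\<close> is negligible (\<open>card_no_kernel_le\<close>).

  If a set \<open>T\<close> of \<open>t + 1\<close> positions lies in all supports, classify the words by their pattern
  on \<open>T\<close>. Two conflicting patterns, that is, patterns that differ in two or more positions, force the supports of their
  words to meet outside \<open>T\<close>, so both classes are negligible. The patterns
  that conflict with no other pattern are pairwise at distance at most one, and adding any conflicting
  pattern to them keeps this property; a set of words pairwise at distance at most one lies on a
  line and so has at most \<open>q - 1\<close> elements here (\<open>card_Hamming_clique_le\<close>). Either all
  patterns are conflict-free and there are at most \<open>q - 1\<close> classes, or at most \<open>q - 2\<close> classes can be
  large and the remaining ones together do not exceed \<open>N\<close> (\<open>card_kernel_le\<close>).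
\<close>

section \<open>Supports and the distance of words of equal weight\<close>

definition supp :: "nat list \<Rightarrow> nat set" where
  "supp x = {i. i < length x \<and> x ! i \<noteq> 0}"

definition const_weight_words :: "nat \<Rightarrow> nat \<Rightarrow> nat \<Rightarrow> nat list set" where
  "const_weight_words q n k = {x \<in> words q n. wt x = k}"

lemma finite_supp [simp]: "finite (supp x)"
  by (simp add: supp_def)

lemma finite_words [simp]: "finite (words q n)"
  using finite_lists_length_eq[of "{0..<q}" n] by (simp add: words_def conj_commute)

lemma finite_const_weight_words [simp]: "finite (const_weight_words q n k)"
  by (simp add: const_weight_words_def)

lemma const_weight_wordsD:
  assumes "x \<in> const_weight_words q n k"
  shows "length x = n" "card (supp x) = k" "supp x \<subseteq> {..<n}" "\<And>i. i \<in> supp x \<Longrightarrow> x ! i \<in> {1..<q}"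
proof -
  show l: "length x = n" and "card (supp x) = k" and s: "supp x \<subseteq> {..<n}"
    using assms by (auto simp: const_weight_words_def words_def wt_def supp_def)
  fix i assume i: "i \<in> supp x"
  then have "x ! i \<in> set x" and "x ! i \<noteq> 0" by (simp_all add: supp_def)
  moreover have "set x \<subseteq> {0..<q}"
    using assms by (simp add: const_weight_words_def words_def)
  ultimately show "x ! i \<in> {1..<q}" by fastforce
qed

lemma map_upt_const_weight_wordsI:
  assumes "\<And>i. i < n \<Longrightarrow> f i < q" and "card {i. i < n \<and> f i \<noteq> 0} = k"
  shows "map f [0..<n] \<in> const_weight_words q n k"
proof -
  have "{i. i < n \<and> map f [0..<n] ! i \<noteq> 0} = {i. i < n \<and> f i \<noteq> 0}"
    by auto
  then show ?thesis
    using assms by (auto simp: const_weight_words_def words_def wt_def)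
qed

text \<open>
  The positions where two words differ split into those in exactly one support and those in both
  supports carrying different letters. This turns every diameter condition into a statement
  about intersections of supports; adding on the left avoids truncated subtraction.
\<close>

lemma hamming_dist_const_weight:
  assumes x: "x \<in> const_weight_words q n k" and y: "y \<in> const_weight_words q n k"
  shows "hamming_dist x y + 2 * card (supp x \<inter> supp y)
    = 2 * k + card {i \<in> supp x \<inter> supp y. x ! i \<noteq> y ! i}"
proof -
  let ?S = "supp x" and ?T = "supp y"
  let ?E = "{i \<in> ?S \<inter> ?T. x ! i \<noteq> y ! i}"
  have l: "length x = n" "length y = n" and c: "card ?S = k" "card ?T = k"
    using const_weight_wordsD[OF x] const_weight_wordsD[OF y] by auto
  have "{i. i < length x \<and> x ! i \<noteq> y ! i} = ((?S - ?T) \<union> (?T - ?S)) \<union> ?E"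
    using l by (auto simp: supp_def)
  then have "hamming_dist x y = card ((?S - ?T) \<union> (?T - ?S)) + card ?E"
    unfolding hamming_dist_def by (simp, subst card_Un_disjoint) auto
  also have "card ((?S - ?T) \<union> (?T - ?S)) = card (?S - ?T) + card (?T - ?S)"
    by (subst card_Un_disjoint) auto
  finally have "hamming_dist x y = card (?S - ?T) + card (?T - ?S) + card ?E" .
  moreover have "card (?S - ?T) + card (?S \<inter> ?T) = k"
    using c card_Int_Diff[of ?S ?T] by simp
  moreover have "card (?T - ?S) + card (?S \<inter> ?T) = k"
    using c card_Int_Diff[of ?T ?S] by (simp add: Int_commute)
  ultimately show ?thesis by simp
qed

section \<open>Counting words with prescribed positions in the support\<close>

definition cylinder :: "nat \<Rightarrow> nat \<Rightarrow> nat \<Rightarrow> nat set \<Rightarrow> (nat \<Rightarrow> nat) \<Rightarrow> nat list set" where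
  "cylinder q n k F u = {x \<in> const_weight_words q n k. \<forall>i\<in>F. x ! i = u i}"

text \<open>
  Outside \<open>F\<close>, a word of the cylinder is determined by the remaining \<open>k - card F\<close> positions of
  its support and by an arbitrary choice of nonzero letters there. The exact value serves as an
  upper bound for the classes of an anticode and as the size of the extremal family.
\<close>

lemma card_cylinder:
  assumes q: "q > 0" and F: "F \<subseteq> {..<n}" and u: "\<And>i. i \<in> F \<Longrightarrow> u i \<in> {1..<q}" and k: "card F \<le> k"
  shows "card (cylinder q n k F u) = ((n - card F) choose (k - card F)) * (q - 1) ^ (k - card F)"
proof -
  let ?R = "{R. R \<subseteq> {..<n} - F \<and> card R = k - card F}"
  let ?I = "Sigma ?R (\<lambda>R. R \<rightarrow>\<^sub>E {1..<q})"
  let ?f = "\<lambda>x. (supp x - F, restrict ((!) x) (supp x - F))"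
  let ?w = "\<lambda>R g i. if i \<in> F then u i else if i \<in> R then g i else (0::nat)"
  let ?g = "\<lambda>(R, g). map (?w R g) [0..<n]"
  have finF: "finite F" using F finite_subset by blast
  have "bij_betw ?f (cylinder q n k F u) ?I"
  proof (rule bij_betw_byWitness[where f' = ?g])
    show "\<forall>x\<in>cylinder q n k F u. ?g (?f x) = x"
    proof
      fix x assume x: "x \<in> cylinder q n k F u"
      then have l: "length x = n" using const_weight_wordsD(1) by (auto simp: cylinder_def)
      show "?g (?f x) = x"
        using x l by (auto intro!: nth_equalityI simp: cylinder_def supp_def)
    qed
  next
    show "\<forall>p\<in>?I. ?f (?g p) = p"
    proof
      fix p assume "p \<in> ?I"
      then obtain R g where p: "p = (R, g)" and R: "R \<subseteq> {..<n} - F" "card R = k - card F"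
        and g: "g \<in> R \<rightarrow>\<^sub>E {1..<q}" by auto
      have nz: "g i \<noteq> 0" if "i \<in> R" for i using PiE_mem[OF g that] by simp
      have s: "supp (?g (R, g)) - F = R"
        using R nz by (auto simp: supp_def split: if_splits)
      moreover have "restrict ((!) (?g (R, g))) R = g"
      proof
        fix i show "restrict ((!) (?g (R, g))) R i = g i"
          using R PiE_arb[OF g] by (cases "i \<in> R") auto
      qed
      ultimately show "?f (?g p) = p" unfolding p by simp
    qed
  next
    show "?f ` cylinder q n k F u \<subseteq> ?I"
    proof (rule image_subsetI)
      fix x assume x: "x \<in> cylinder q n k F u"
      then have xw: "x \<in> const_weight_words q n k" by (simp add: cylinder_def)
      have "F \<subseteq> supp x"
        using x F u const_weight_wordsD(1)[OF xw] by (fastforce simp: cylinder_def supp_def)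
      then have "card (supp x - F) = k - card F"
        using const_weight_wordsD(2)[OF xw] finF by (simp add: card_Diff_subset)
      then show "?f x \<in> ?I"
        using const_weight_wordsD(3,4)[OF xw] by auto
    qed
  next
    show "?g ` ?I \<subseteq> cylinder q n k F u"
    proof
      fix x assume "x \<in> ?g ` ?I"
      then obtain R g where x: "x = ?g (R, g)" and R: "R \<subseteq> {..<n} - F" "card R = k - card F"
        and g: "g \<in> R \<rightarrow>\<^sub>E {1..<q}" by auto
      have g': "g i \<in> {1..<q}" if "i \<in> R" for i using PiE_mem[OF g that] .
      have "{i. i < n \<and> ?w R g i \<noteq> 0} = F \<union> R"
        using F R u g' by (fastforce split: if_splits)
      moreover have "card (F \<union> R) = k"
        using R k finF by (subst card_Un_disjoint) (auto intro: finite_subset)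
      ultimately show "x \<in> cylinder q n k F u"
        unfolding x using F u g' q by (auto simp: cylinder_def intro!: map_upt_const_weight_wordsI)
    qed
  qed
  then have "card (cylinder q n k F u) = card ?I" by (rule bij_betw_same_card)
  also have "\<dots> = (\<Sum>R\<in>?R. card (R \<rightarrow>\<^sub>E {1..<q}))"
    by (rule card_SigmaI) (auto intro!: finite_PiE intro: finite_subset)
  also have "\<dots> = (\<Sum>R\<in>?R. (q - 1) ^ (k - card F))"
  proof (rule sum.cong)
    fix R assume "R \<in> ?R"
    then show "card (R \<rightarrow>\<^sub>E {1..<q}) = (q - 1) ^ (k - card F)"
      using card_PiE[of R "\<lambda>_. {1..<q}"] by (auto dest: finite_subset)
  qed simp
  also have "\<dots> = card ?R * (q - 1) ^ (k - card F)" by simp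
  also have "card ?R = (card ({..<n} - F) choose (k - card F))"
    by (rule n_subsets) simp
  also have "card ({..<n} - F) = n - card F"
    using F finF by (simp add: card_Diff_subset)
  finally show ?thesis .
qed

text \<open>
  An upper bound for the number of words of weight \<open>k\<close> whose support contains \<open>s\<close> prescribed
  positions. Truncated subtraction would give \<open>(n - s) choose 0 = 1\<close> for \<open>s > k\<close>, where there is
  no such word; the exact value zero matters for \<open>k = t + 1\<close>, when nothing may be lost.
\<close>

definition star_bound :: "nat \<Rightarrow> nat \<Rightarrow> nat \<Rightarrow> nat \<Rightarrow> nat" where
  "star_bound q n k s = (q - 1) ^ k * (if s \<le> k then (n - s) choose (k - s) else 0)"

lemma card_UN_le_mult:
  assumes "finite I" and "\<And>i. i \<in> I \<Longrightarrow> card (f i) \<le> (K::nat)"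
  shows "card (\<Union>i\<in>I. f i) \<le> card I * K"
  using card_UN_le[OF assms(1), of f] sum_bounded_above[of I "\<lambda>i. card (f i)" K] assms(2)
  by fastforce

lemma card_star_le:
  assumes q: "q > 0"
  shows "card {x \<in> const_weight_words q n k. F \<subseteq> supp x} \<le> star_bound q n k (card F)"
    (is "card ?X \<le> _")
proof (cases "?X = {}")
  case False
  then obtain y where y: "y \<in> const_weight_words q n k" "F \<subseteq> supp y" by blast
  then have F: "F \<subseteq> {..<n}" and k: "card F \<le> k"
    using const_weight_wordsD[OF y(1)] card_mono[of "supp y" F] by auto
  have finF: "finite F" using F finite_subset by blast
  have "?X \<subseteq> (\<Union>u\<in>F \<rightarrow>\<^sub>E {1..<q}. cylinder q n k F u)"
  proof
    fix x assume x: "x \<in> ?X"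
    then have "restrict ((!) x) F \<in> F \<rightarrow>\<^sub>E {1..<q}"
      using const_weight_wordsD(4)[of x q n k] by (auto simp: subset_iff)
    moreover have "x \<in> cylinder q n k F (restrict ((!) x) F)"
      using x by (simp add: cylinder_def)
    ultimately show "x \<in> (\<Union>u\<in>F \<rightarrow>\<^sub>E {1..<q}. cylinder q n k F u)" by blast
  qed
  then have "card ?X \<le> card (\<Union>u\<in>F \<rightarrow>\<^sub>E {1..<q}. cylinder q n k F u)"
    using finF by (intro card_mono) (auto intro!: finite_PiE simp: cylinder_def)
  also have "\<dots> \<le> card (F \<rightarrow>\<^sub>E {1..<q}) * (((n - card F) choose (k - card F)) * (q - 1) ^ (k - card F))"
  proof (rule card_UN_le_mult)
    fix u assume "u \<in> F \<rightarrow>\<^sub>E {1..<q}"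
    then have "u i \<in> {1..<q}" if "i \<in> F" for i using that by (rule PiE_mem)
    then show "card (cylinder q n k F u) \<le> ((n - card F) choose (k - card F)) * (q - 1) ^ (k - card F)"
      using card_cylinder[OF q F _ k] by simp
  qed (use finF in \<open>auto intro!: finite_PiE\<close>)
  also have "card (F \<rightarrow>\<^sub>E {1..<q}) = (q - 1) ^ card F"
    using finF by (simp add: card_PiE)
  also have "(q - 1) ^ card F * (((n - card F) choose (k - card F)) * (q - 1) ^ (k - card F))
      = star_bound q n k (card F)"
    using k power_add[of "q - 1" "card F" "k - card F"] by (simp add: star_bound_def)
  finally show ?thesis .
next
  case True
  show ?thesis unfolding True by simp
qed

text \<open>
  Both cases of the argument produce words whose support contains \<open>F\<close> and must also hit a set \<open>Y\<close>
  of bounded size disjoint from \<open>F\<close>: choosing the position hit gains one prescribed position, hence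
  one order of magnitude in \<open>n\<close>, at the cost of a factor \<open>k\<close>.
\<close>

lemma card_star_meeting_le:
  assumes q: "q > 0" and F: "finite F" and Y: "finite Y" "Y \<inter> F = {}" "card Y \<le> k"
  shows "card {x \<in> const_weight_words q n k. F \<subseteq> supp x \<and> supp x \<inter> Y \<noteq> {}}
    \<le> k * star_bound q n k (Suc (card F))" (is "card ?X \<le> _")
proof -
  let ?G = "\<lambda>y. {x \<in> const_weight_words q n k. insert y F \<subseteq> supp x}"
  have "card ?X \<le> card (\<Union>y\<in>Y. ?G y)"
    using Y(1) by (intro card_mono) auto
  also have "\<dots> \<le> card Y * star_bound q n k (Suc (card F))"
  proof (rule card_UN_le_mult)
    fix y assume "y \<in> Y"
    then have "card (insert y F) = Suc (card F)" using F Y(2) by (simp add: disjoint_iff)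
    then show "card (?G y) \<le> star_bound q n k (Suc (card F))"
      using card_star_le[OF q, of n k "insert y F"] by simp
  qed (rule Y(1))
  also have "\<dots> \<le> k * star_bound q n k (Suc (card F))"
    using Y(3) by (rule mult_le_mono1)
  finally show ?thesis .
qed

text \<open>
  With \<open>j = k - t - 2\<close> and \<open>m = n - t - 2\<close>, the absorption identity for binomial coefficients says
  that \<open>(m + 1 choose j + 1)\<close> exceeds \<open>(m choose j)\<close> by the factor \<open>(m + 1) / (j + 1)\<close>, which
  outgrows any constant.
\<close>

lemma star_bound_negligible:
  assumes q: "q > 1" and t: "t < k" and n: "n \<ge> t + 2 + k * C * (q - 1) ^ k"
  shows "C * star_bound q n k (t + 2)
    \<le> ((n - (t + 1)) choose (k - (t + 1))) * (q - 1) ^ (k - (t + 1))"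
proof (cases "k = t + 1")
  case True
  then show ?thesis by (simp add: star_bound_def)
next
  case False
  define j where "j = k - (t + 2)"
  define m where "m = n - (t + 2)"
  have k: "k = t + 2 + j" and n': "n = t + 2 + m"
    using False t n by (auto simp: j_def m_def)
  have "Suc j * (C * (q - 1) ^ k) \<le> k * (C * (q - 1) ^ k)"
    using k by (intro mult_le_mono1) simp
  also have "\<dots> \<le> Suc m" using n n' by (simp add: mult.assoc)
  finally have "Suc j * (C * (q - 1) ^ k) * (m choose j) \<le> Suc m * (m choose j)"
    by (rule mult_le_mono1)
  also have "\<dots> = Suc j * (Suc m choose Suc j)" by (rule Suc_times_binomial[symmetric])
  finally have "Suc j * (C * (q - 1) ^ k * (m choose j)) \<le> Suc j * (Suc m choose Suc j)"
    by (simp only: mult.assoc)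
  then have "C * (q - 1) ^ k * (m choose j) \<le> Suc m choose Suc j"
    by (simp only: Suc_mult_le_cancel1)
  also have "\<dots> \<le> (Suc m choose Suc j) * (q - 1) ^ Suc j"
    using q one_le_power[of "q - 1" "Suc j"] by (simp del: power_Suc)
  finally show ?thesis by (simp add: star_bound_def k n' mult.assoc)
qed

section \<open>Families of words without a common kernel\<close>

text \<open>
  Every support meets the support of a fixed word \<open>x\<^sub>0\<close> in at least \<open>s\<close> positions, so contains one
  of at most \<open>2 ^ k\<close> sets \<open>F\<close> of size \<open>s\<close>. Since \<open>F\<close> is not in all supports, some word \<open>z F\<close> shares
  fewer than \<open>s\<close> positions with \<open>F\<close>; a support containing \<open>F\<close> must make up for this by a position
  of \<open>z F\<close> outside \<open>F\<close>.
\<close>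

lemma card_no_kernel_le:
  assumes q: "q > 0" and B: "B \<subseteq> const_weight_words q n k"
    and meet: "\<And>x y. x \<in> B \<Longrightarrow> y \<in> B \<Longrightarrow> s \<le> card (supp x \<inter> supp y)"
    and no_kernel: "\<And>F. card F = s \<Longrightarrow> \<exists>x\<in>B. \<not> F \<subseteq> supp x"
  shows "card B \<le> 2 ^ k * (k * star_bound q n k (Suc s))"
proof (cases "B = {}")
  case False
  then obtain x\<^sub>0 where x0: "x\<^sub>0 \<in> B" by blast
  let ?I = "{F. F \<subseteq> supp x\<^sub>0 \<and> card F = s}"
  obtain z where z: "z F \<in> B" "\<not> F \<subseteq> supp (z F)" if "card F = s" for F
    using no_kernel by metis
  let ?X = "\<lambda>F. {x \<in> const_weight_words q n k. F \<subseteq> supp x \<and> supp x \<inter> (supp (z F) - F) \<noteq> {}}"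
  have finI: "finite ?I" by (rule finite_subset[of _ "Pow (supp x\<^sub>0)"]) auto
  have "B \<subseteq> (\<Union>F\<in>?I. ?X F)"
  proof
    fix x assume x: "x \<in> B"
    obtain F where F: "F \<subseteq> supp x \<inter> supp x\<^sub>0" "card F = s"
      using meet[OF x x0] by (rule obtain_subset_with_card_n)
    have finF: "finite F" using F(1) finite_subset by fastforce
    have "supp x \<inter> (supp (z F) - F) \<noteq> {}"
    proof
      assume "supp x \<inter> (supp (z F) - F) = {}"
      then have "supp x \<inter> supp (z F) \<subset> F" using z(2)[OF F(2)] by blast
      then have "card (supp x \<inter> supp (z F)) < s"
        using psubset_card_mono[OF finF] F(2) by blast
      then show False using meet[OF x z(1)[OF F(2)]] by simp
    qed
    then show "x \<in> (\<Union>F\<in>?I. ?X F)" using x F B by blast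
  qed
  then have "card B \<le> card (\<Union>F\<in>?I. ?X F)"
    using finI by (intro card_mono) auto
  also have "\<dots> \<le> card ?I * (k * star_bound q n k (Suc s))"
  proof (rule card_UN_le_mult[OF finI])
    fix F assume F: "F \<in> ?I"
    have "card (supp (z F) - F) \<le> card (supp (z F))" by (intro card_mono) auto
    also have "\<dots> = k" using z(1) F B const_weight_wordsD(2) by blast
    finally show "card (?X F) \<le> k * star_bound q n k (Suc s)"
      using F card_star_meeting_le[OF q, of F "supp (z F) - F" k n]
      by (auto dest: finite_subset[OF _ finite_supp])
  qed
  also have "card ?I \<le> card (Pow (supp x\<^sub>0))" by (intro card_mono) auto
  also have "\<dots> = 2 ^ k" using x0 B const_weight_wordsD(2)[of x\<^sub>0 q n k] by (auto simp: card_Pow)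
  finally show ?thesis by simp
qed simp

section \<open>Families of words with a common kernel\<close>

text \<open>
  If \<open>u\<close> and \<open>v\<close> differ exactly at \<open>i\<close>, a third member differing from \<open>u\<close> at another
  position \<open>j\<close> would differ from \<open>v\<close> at both \<open>i\<close> and \<open>j\<close>. So all members agree off \<open>i\<close> and are
  told apart by their letter at \<open>i\<close>.
\<close>

lemma card_Hamming_clique_le:
  assumes q: "q > 1" and T: "finite T" and P: "P \<subseteq> T \<rightarrow>\<^sub>E {1..<q}"
    and close: "\<And>u v. u \<in> P \<Longrightarrow> v \<in> P \<Longrightarrow> card {i \<in> T. u i \<noteq> v i} \<le> 1"
  shows "card P \<le> q - 1"
proof (cases "\<exists>u\<in>P. \<exists>v\<in>P. u \<noteq> v")
  case True
  then obtain u v where uv: "u \<in> P" "v \<in> P" "u \<noteq> v" by blast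
  have close': "i = j" if "u' \<in> P" "v' \<in> P" "i \<in> T" "j \<in> T" "u' i \<noteq> v' i" "u' j \<noteq> v' j" for u' v' i j
    using close[OF that(1,2)] T that(3-) by (simp add: card_le_Suc0_iff_eq)
  obtain i where i: "i \<in> T" "u i \<noteq> v i"
    using uv P PiE_ext[of u T "\<lambda>_. {1..<q}" v] by blast
  have same: "w j = u j" if "w \<in> P" "j \<in> T" "j \<noteq> i" for w j
  proof (rule ccontr)
    assume w: "w j \<noteq> u j"
    have "v j = u j" using close'[of v u j i] uv i that by metis
    moreover have "w i = u i" using close'[of w u j i] uv i that w by metis
    ultimately show False using close'[of w v j i] uv i that w by metis
  qed
  have "inj_on (\<lambda>w. w i) P"
  proof (rule inj_onI)
    fix w w' assume ww: "w \<in> P" "w' \<in> P" "w i = w' i"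
    then have "w j = w' j" if "j \<in> T" for j using same that by metis
    then show "w = w'" using ww P PiE_ext[of w T "\<lambda>_. {1..<q}" w'] by blast
  qed
  moreover have "(\<lambda>w. w i) ` P \<subseteq> {1..<q}" using P i by auto
  ultimately have "card P \<le> card {1..<q}" by (rule card_inj_on_le) simp
  then show ?thesis by simp
next
  case False
  then have "\<forall>u\<in>P. \<forall>v\<in>P. u = v" by blast
  moreover have "finite P" by (rule finite_subset[OF P]) (auto intro: finite_PiE T)
  ultimately have "card P \<le> 1" by (simp add: card_le_Suc0_iff_eq)
  then show ?thesis using q by simp
qed

text \<open>
  The exact bound. Its point is that a single conflict between patterns costs a whole class: \<open>U\<close>
  collects the patterns without conflict, and a pattern \<open>v\<close> outside \<open>U\<close> still extends \<open>U\<close>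
  to a clique, because members of \<open>U\<close> conflict with no pattern, not even with \<open>v\<close>. This leaves room for
  only \<open>q - 2\<close> patterns in \<open>U\<close>, and the freed \<open>N\<close> absorbs all conflicting classes.
\<close>

lemma card_kernel_le:
  assumes q: "q > 1" and T: "T \<subseteq> {..<n}" "card T = t + 1" and k: "t < k"
    and B: "B \<subseteq> const_weight_words q n k" and kernel: "\<And>x. x \<in> B \<Longrightarrow> T \<subseteq> supp x"
    and meet: "\<And>x y. x \<in> B \<Longrightarrow> y \<in> B \<Longrightarrow>
      2 * t + 1 + card {i \<in> supp x \<inter> supp y. x ! i \<noteq> y ! i} \<le> 2 * card (supp x \<inter> supp y)"
    and N: "N = ((n - (t + 1)) choose (k - (t + 1))) * (q - 1) ^ (k - (t + 1))"
    and small: "(q - 1) ^ (t + 1) * (k * star_bound q n k (t + 2)) \<le> N"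
  shows "card B \<le> (q - 1) * N"
proof -
  define pattern where "pattern x = restrict ((!) x) T" for x :: "nat list"
  define P where "P = pattern ` B"
  define fibre where "fibre u = {x \<in> B. pattern x = u}" for u
  define U where "U = {u \<in> P. \<forall>v\<in>P. card {i \<in> T. u i \<noteq> v i} \<le> 1}"
  have finT: "finite T" using T(1) finite_subset by blast
  have finB: "finite B" using B finite_subset finite_const_weight_words by blast
  have P: "P \<subseteq> T \<rightarrow>\<^sub>E {1..<q}"
  proof
    fix u assume "u \<in> P"
    then obtain x where "x \<in> B" "u = pattern x" unfolding P_def by blast
    then show "u \<in> T \<rightarrow>\<^sub>E {1..<q}"
      using B kernel const_weight_wordsD(4)[of x q n k] unfolding pattern_def by (auto simp: subset_iff)
  qed
  have finP: "finite P" using finB by (simp add: P_def)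
  have UP: "U \<subseteq> P" by (auto simp: U_def)
  have fibre_le: "card (fibre u) \<le> N" if "u \<in> P" for u
  proof -
    have "fibre u \<subseteq> cylinder q n k T u"
      using B by (auto simp: fibre_def pattern_def cylinder_def)
    then have "card (fibre u) \<le> card (cylinder q n k T u)"
      by (rule card_mono[rotated]) (simp add: cylinder_def)
    also have "\<dots> = N"
      using card_cylinder[of q T n u k] PiE_mem[of u T "\<lambda>_. {1..<q}"] P that T q k N by auto
    finally show ?thesis .
  qed
  have fibre_small: "card (fibre u) \<le> k * star_bound q n k (t + 2)" if u: "u \<in> P - U" for u
  proof -
    obtain v where v: "v \<in> P" "card {i \<in> T. u i \<noteq> v i} > 1"
      using u unfolding U_def by fastforce
    then obtain y where y: "y \<in> B" "v = pattern y" unfolding P_def by blast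
    have "fibre u \<subseteq> {x \<in> const_weight_words q n k. T \<subseteq> supp x \<and> supp x \<inter> (supp y - T) \<noteq> {}}"
    proof
      fix x assume x: "x \<in> fibre u"
      then have xB: "x \<in> B" and xu: "u = pattern x" by (auto simp: fibre_def)
      have "supp x \<inter> (supp y - T) \<noteq> {}"
      proof
        assume "supp x \<inter> (supp y - T) = {}"
        then have ST: "supp x \<inter> supp y = T" using kernel[OF xB] kernel[OF y(1)] by blast
        have "{i \<in> T. u i \<noteq> v i} = {i \<in> T. x ! i \<noteq> y ! i}"
          using xu y(2) by (auto simp: pattern_def)
        \<comment> \<open>Then \<open>c = t + 1\<close> and \<open>e \<ge> 2\<close>, contradicting \<open>2 t + 1 + e \<le> 2 c\<close>.\<close>
        then show False using meet[OF xB y(1)] v(2) T(2) unfolding ST by simp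
      qed
      then show "x \<in> {x \<in> const_weight_words q n k. T \<subseteq> supp x \<and> supp x \<inter> (supp y - T) \<noteq> {}}"
        using xB B kernel by blast
    qed
    then have "card (fibre u)
        \<le> card {x \<in> const_weight_words q n k. T \<subseteq> supp x \<and> supp x \<inter> (supp y - T) \<noteq> {}}"
      by (intro card_mono) auto
    also have "\<dots> \<le> k * star_bound q n k (Suc (card T))"
    proof (rule card_star_meeting_le)
      have "card (supp y - T) \<le> card (supp y)" by (intro card_mono) auto
      then show "card (supp y - T) \<le> k" using y(1) B const_weight_wordsD(2)[of y q n k] by auto
    qed (use q finT in auto)
    finally show ?thesis using T(2) by simp
  qed
  have B_eq: "B = (\<Union>u\<in>P. fibre u)" by (auto simp: P_def fibre_def)
  show ?thesis
  proof (cases "U = P")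
    case True
    have "card P \<le> q - 1"
      using True q finT P by (intro card_Hamming_clique_le[of q T]) (auto simp: U_def)
    moreover have "card B \<le> card P * N"
      by (subst B_eq) (rule card_UN_le_mult[OF finP fibre_le])
    ultimately show ?thesis using mult_le_mono1 le_trans by blast
  next
    case False
    then obtain v where v: "v \<in> P" "v \<notin> U" using UP by blast
    have sym: "card {i \<in> T. u i \<noteq> w i} = card {i \<in> T. w i \<noteq> u i}" for u w :: "nat \<Rightarrow> nat"
      by (rule arg_cong[of _ _ card]) auto
    have "card (insert v U) \<le> q - 1"
    proof (rule card_Hamming_clique_le[OF q finT])
      show "insert v U \<subseteq> T \<rightarrow>\<^sub>E {1..<q}" using v UP P by blast
      fix u w assume uw: "u \<in> insert v U" "w \<in> insert v U"
      show "card {i \<in> T. u i \<noteq> w i} \<le> 1"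
      proof (cases "u = v \<and> w = v")
        case True
        then show ?thesis by simp
      next
        case False
        then have "u \<in> U \<and> w \<in> P \<or> w \<in> U \<and> u \<in> P" using uw v UP by blast
        then show ?thesis using sym[of u w] unfolding U_def by auto
      qed
    qed
    then have cU: "card U + 1 \<le> q - 1" using v finite_subset[OF UP finP] by simp
    have "card (P - U) \<le> card (T \<rightarrow>\<^sub>E {1..<q})"
      using P finT by (intro card_mono) (auto intro: finite_PiE)
    then have cPU: "card (P - U) \<le> (q - 1) ^ (t + 1)"
      using finT T(2) by (simp add: card_PiE)
    have B_Un: "B = (\<Union>u\<in>U. fibre u) \<union> (\<Union>u\<in>P - U. fibre u)"
      using B_eq UP by blast
    have "card B \<le> card (\<Union>u\<in>U. fibre u) + card (\<Union>u\<in>P - U. fibre u)"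
      by (subst B_Un) (rule card_Un_le)
    also have "card (\<Union>u\<in>U. fibre u) \<le> card U * N"
      using UP finite_subset[OF UP finP] fibre_le by (intro card_UN_le_mult) auto
    also have "card (\<Union>u\<in>P - U. fibre u) \<le> card (P - U) * (k * star_bound q n k (t + 2))"
      using finP fibre_small by (intro card_UN_le_mult) auto
    also have "\<dots> \<le> (q - 1) ^ (t + 1) * (k * star_bound q n k (t + 2))"
      using cPU by (rule mult_le_mono1)
    also have "\<dots> \<le> N" by (rule small)
    finally have "card B \<le> (card U + 1) * N" by simp
    also have "\<dots> \<le> (q - 1) * N" using cU by (rule mult_le_mono1)
    finally show ?thesis .
  qed
qed

section \<open>The extremal anticode\<close>

lemma wt_ones_nonzero: "a \<noteq> 0 \<Longrightarrow> wt (replicate t 1 @ [a] @ b) = t + 1 + wt b"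
  unfolding wt_def length_filter_conv_card[of "\<lambda>a. a \<noteq> 0", symmetric] by simp

lemma \<A>_iff:
  assumes t: "t < k" and n: "t < n"
  shows "x \<in> \<A> q t k n \<longleftrightarrow> x \<in> const_weight_words q n k \<and> (\<forall>i<t. x ! i = 1) \<and> x ! t \<noteq> 0"
proof
  assume "x \<in> \<A> q t k n"
  then obtain a b where x: "x \<in> words q n" "x = replicate t 1 @ [a] @ b" and a: "a \<noteq> 0"
    and b: "wt b = k - t - 1"
    unfolding \<A>_def by blast
  have "wt x = k"
    using b t unfolding x(2) wt_ones_nonzero[OF a] by simp
  then show "x \<in> const_weight_words q n k \<and> (\<forall>i<t. x ! i = 1) \<and> x ! t \<noteq> 0"
    using x a by (auto simp: const_weight_words_def nth_append)
next
  assume x: "x \<in> const_weight_words q n k \<and> (\<forall>i<t. x ! i = 1) \<and> x ! t \<noteq> 0"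
  then have l: "length x = n" and w: "wt x = k" "x \<in> words q n"
    using const_weight_wordsD(1) by (auto simp: const_weight_words_def)
  have "take t x = replicate t 1"
    using x l n by (intro nth_equalityI) auto
  then have eq: "x = replicate t 1 @ [x ! t] @ drop (Suc t) x"
    using id_take_nth_drop[of t x] l n by simp
  have "wt x = t + 1 + wt (drop (Suc t) x)"
    using x wt_ones_nonzero[of "x ! t" t "drop (Suc t) x"] eq by metis
  then show "x \<in> \<A> q t k n"
    using eq w x unfolding \<A>_def by auto
qed

lemma card_\<A>:
  assumes q: "q > 1" and t: "t < k" and n: "t < n"
  shows "card (\<A> q t k n)
    = (q - 1) * (((n - (t + 1)) choose (k - (t + 1))) * (q - 1) ^ (k - (t + 1)))"
proof -
  let ?u = "\<lambda>a i. if i < t then 1 else (a::nat)"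
  have "\<A> q t k n = (\<Union>a\<in>{1..<q}. cylinder q n k {..t} (?u a))" (is "_ = ?V")
  proof
    show "?V \<subseteq> \<A> q t k n"
      using \<A>_iff[OF t n] by (fastforce simp: cylinder_def)
    show "\<A> q t k n \<subseteq> ?V"
    proof
      fix x assume "x \<in> \<A> q t k n"
      then have x: "x \<in> const_weight_words q n k" "\<forall>i<t. x ! i = 1" "x ! t \<noteq> 0"
        using \<A>_iff[OF t n] by auto
      then have "t \<in> supp x" using n const_weight_wordsD(1)[OF x(1)] by (simp add: supp_def)
      then have "x ! t \<in> {1..<q}" by (rule const_weight_wordsD(4)[OF x(1)])
      moreover have "x \<in> cylinder q n k {..t} (?u (x ! t))"
        using x by (auto simp: cylinder_def)
      ultimately show "x \<in> ?V" by blast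
    qed
  qed
  moreover have "card ?V = (\<Sum>a\<in>{1..<q}. card (cylinder q n k {..t} (?u a)))"
    by (rule card_UN_disjoint) (auto simp: cylinder_def)
  moreover have "card (cylinder q n k {..t} (?u a))
      = ((n - (t + 1)) choose (k - (t + 1))) * (q - 1) ^ (k - (t + 1))" if "a \<in> {1..<q}" for a
    using card_cylinder[of q "{..t}" n "?u a" k] that q t n by (auto simp: subset_iff)
  ultimately show ?thesis by simp
qed

text \<open>
  The supports share \<open>c \<ge> t + 1\<close> positions, and the letters agree on the first \<open>t\<close> of them, so
  \<open>e \<le> c - t\<close> and the distance \<open>2 k - 2 c + e\<close> is at most \<open>2 k - c - t\<close>.
\<close>

lemma hamming_dist_\<A>_le:
  assumes t: "t < k" and n: "t < n" and x: "x \<in> \<A> q t k n" and y: "y \<in> \<A> q t k n"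
  shows "hamming_dist x y \<le> 2 * (k - t) - 1"
proof -
  let ?S = "supp x \<inter> supp y"
  have x': "x \<in> const_weight_words q n k" "\<forall>i<t. x ! i = 1" "x ! t \<noteq> 0"
    and y': "y \<in> const_weight_words q n k" "\<forall>i<t. y ! i = 1" "y ! t \<noteq> 0"
    using \<A>_iff[OF t n] x y by auto
  have sub: "{..t} \<subseteq> ?S"
    using x' y' n const_weight_wordsD(1)[OF x'(1)] const_weight_wordsD(1)[OF y'(1)]
    by (auto simp: supp_def le_less)
  have c: "t + 1 \<le> card ?S" using card_mono[OF _ sub] by simp
  have "{i \<in> ?S. x ! i \<noteq> y ! i} \<subseteq> ?S - {..<t}" using x' y' by auto
  then have "card {i \<in> ?S. x ! i \<noteq> y ! i} \<le> card (?S - {..<t})" by (intro card_mono) auto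
  also have "\<dots> = card ?S - t" using sub by (subst card_Diff_subset) auto
  finally show ?thesis
    using hamming_dist_const_weight[OF x'(1) y'(1)] c t by linarith
qed

text \<open>
  The two words carry the letters 1 and 2 at position \<open>t\<close>, and their supports share only the
  positions up to \<open>t\<close>, for which length \<open>2 k\<close> leaves enough space. So \<open>c = t + 1\<close> and
  \<open>e = 1\<close>; this is where a second nonzero letter, \<open>q > 2\<close>, is needed.
\<close>

lemma \<A>_diametral_pair:
  assumes q: "q > 2" and t: "t < k" and n: "2 * k \<le> n"
  shows "\<exists>x\<in>\<A> q t k n. \<exists>y\<in>\<A> q t k n. hamming_dist x y = 2 * (k - t) - 1"
proof -
  define f where "f i = (if i < k then 1 else (0::nat))" for i
  define g where "g i = (if i < t then 1 else if i = t then 2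
    else if k \<le> i \<and> i < 2 * k - t - 1 then 1 else (0::nat))" for i
  define x where "x = map f [0..<n]"
  define y where "y = map g [0..<n]"
  have nz_f: "{i. i < n \<and> f i \<noteq> 0} = {..<k}" using n by (auto simp: f_def)
  have nz_g: "{i. i < n \<and> g i \<noteq> 0} = {..t} \<union> {k..<2 * k - t - 1}" using n t by (auto simp: g_def)
  have sx: "supp x = {..<k}" using nz_f by (auto simp: supp_def x_def cong: conj_cong)
  have sy: "supp y = {..t} \<union> {k..<2 * k - t - 1}"
    using nz_g by (auto simp: supp_def y_def cong: conj_cong)
  have x: "x \<in> const_weight_words q n k"
    unfolding x_def using q nz_f by (intro map_upt_const_weight_wordsI) (simp_all add: f_def)
  have "card ({..t} \<union> {k..<2 * k - t - 1}) = k"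
    using t by (subst card_Un_disjoint) auto
  then have y: "y \<in> const_weight_words q n k"
    unfolding y_def using q nz_g by (intro map_upt_const_weight_wordsI) (simp_all add: g_def)
  have "x \<in> \<A> q t k n" "y \<in> \<A> q t k n"
    using x y t n \<A>_iff[of t k n _ q] by (auto simp: x_def y_def f_def g_def)
  moreover have "hamming_dist x y = 2 * (k - t) - 1"
  proof -
    have S: "supp x \<inter> supp y = {..t}" using t unfolding sx sy by auto
    have "x ! i = f i" "y ! i = g i" if "i \<le> t" for i
      using that t n by (simp_all add: x_def y_def)
    then have "{i \<in> {..t}. x ! i \<noteq> y ! i} = {t}"
      using t by (auto simp: f_def g_def split: if_splits)
    then show ?thesis
      using hamming_dist_const_weight[OF x y] t unfolding S by simp
  qed
  ultimately show ?thesis by blast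
qed

lemma hamming_dists_eq: "{hamming_dist x y | x y. x \<in> B \<and> y \<in> B}
    = (\<lambda>(x, y). hamming_dist x y) ` (B \<times> B)"
  by auto

lemma anticodeD:
  assumes "anticode q n D k B"
  shows "B \<subseteq> const_weight_words q n k" "\<And>x y. x \<in> B \<Longrightarrow> y \<in> B \<Longrightarrow> hamming_dist x y \<le> D"
proof -
  show sub: "B \<subseteq> const_weight_words q n k"
    using assms by (auto simp: anticode_def const_weight_words_def)
  have fin: "finite B" using sub finite_subset finite_const_weight_words by blast
  fix x y assume "x \<in> B" "y \<in> B"
  then have "hamming_dist x y \<in> {hamming_dist x y | x y. x \<in> B \<and> y \<in> B}" by blast
  moreover have "finite {hamming_dist x y | x y. x \<in> B \<and> y \<in> B}"
    using fin by (simp add: hamming_dists_eq)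
  ultimately have "hamming_dist x y \<le> diameter B"
    unfolding diameter_def by (rule Max_ge[rotated])
  then show "hamming_dist x y \<le> D" using assms by (simp add: anticode_def)
qed

lemma anticode_\<A>:
  assumes q: "q > 2" and t: "t < k" and n: "2 * k \<le> n"
  shows "anticode q n (2 * (k - t) - 1) k (\<A> q t k n)"
proof -
  have tn: "t < n" using t n by simp
  have sub: "\<A> q t k n \<subseteq> const_weight_words q n k" using \<A>_iff[OF t tn] by blast
  have fin: "finite (\<A> q t k n)" using sub finite_subset finite_const_weight_words by blast
  obtain x y where xy: "x \<in> \<A> q t k n" "y \<in> \<A> q t k n" "hamming_dist x y = 2 * (k - t) - 1"
    using \<A>_diametral_pair[OF q t n] by blast
  have "diameter (\<A> q t k n) = 2 * (k - t) - 1"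
    unfolding diameter_def
  proof (rule Max_eqI)
    show "finite {hamming_dist x y | x y. x \<in> \<A> q t k n \<and> y \<in> \<A> q t k n}"
      using fin by (simp add: hamming_dists_eq)
    show "2 * (k - t) - 1 \<in> {hamming_dist x y | x y. x \<in> \<A> q t k n \<and> y \<in> \<A> q t k n}"
      using xy by force
  qed (use hamming_dist_\<A>_le[OF t tn] in blast)
  then show ?thesis
    using sub xy(1) by (auto simp: anticode_def const_weight_words_def)
qed

section \<open>Optimality\<close>

text \<open>
  The constant \<open>2 ^ k * k + (q - 1) ^ (t + 1) * k\<close> is the sum of those met in the two cases: it
  bounds the number of \<open>(t + 2)\<close>-sets that occur when there is no common kernel, respectively those
  attached to conflicting patterns on a common kernel.
\<close>

lemma card_anticode_le:
  assumes q: "q > 1" and t: "t < k" and n: "t + 2 + k * (2 ^ k * k + (q - 1) ^ (t + 1) * k) * (q - 1) ^ k \<le> n"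
    and B: "anticode q n (2 * (k - t) - 1) k B"
  shows "card B \<le> card (\<A> q t k n)"
proof -
  define N where "N = ((n - (t + 1)) choose (k - (t + 1))) * (q - 1) ^ (k - (t + 1))"
  have N_le: "N \<le> (q - 1) * N" using q by (cases "q - 1") simp_all
  have card\<A>: "card (\<A> q t k n) = (q - 1) * N"
    unfolding N_def using q t by (rule card_\<A>) (use n in linarith)
  have negl: "(2 ^ k * k + (q - 1) ^ (t + 1) * k) * star_bound q n k (t + 2) \<le> N"
    unfolding N_def using q t n by (rule star_bound_negligible)
  have sub: "B \<subseteq> const_weight_words q n k" using anticodeD(1)[OF B] .
  have meet: "2 * t + 1 + card {i \<in> supp x \<inter> supp y. x ! i \<noteq> y ! i} \<le> 2 * card (supp x \<inter> supp y)"
    if "x \<in> B" "y \<in> B" for x y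
  proof -
    have "x \<in> const_weight_words q n k" "y \<in> const_weight_words q n k" using sub that by auto
    from hamming_dist_const_weight[OF this] anticodeD(2)[OF B that] t
    show ?thesis by linarith
  qed
  show ?thesis
  proof (cases "\<exists>T. card T = t + 1 \<and> (\<forall>x\<in>B. T \<subseteq> supp x)")
    case True
    then obtain T where T: "card T = t + 1" "\<And>x. x \<in> B \<Longrightarrow> T \<subseteq> supp x" by blast
    obtain x where x: "x \<in> B" using B by (auto simp: anticode_def)
    have "T \<subseteq> {..<n}" using T(2)[OF x] const_weight_wordsD(3)[of x q n k] sub x by blast
    moreover have "(q - 1) ^ (t + 1) * (k * star_bound q n k (t + 2)) \<le> N"
      using negl by (simp add: algebra_simps)
    ultimately show ?thesis
      unfolding card\<A> using card_kernel_le[OF q _ T(1) t sub T(2) meet N_def] by blast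
  next
    case False
    have "card B \<le> 2 ^ k * (k * star_bound q n k (Suc (t + 1)))"
    proof (rule card_no_kernel_le[of q B n k "t + 1"])
      show "t + 1 \<le> card (supp x \<inter> supp y)" if "x \<in> B" "y \<in> B" for x y
        using meet[OF that] by simp
      show "\<exists>x\<in>B. \<not> F \<subseteq> supp x" if "card F = t + 1" for F using False that by blast
    qed (use q sub in simp_all)
    also have "\<dots> \<le> N" using negl by (simp add: algebra_simps)
    finally show ?thesis unfolding card\<A> using N_le by linarith
  qed
qed

text \<open>
  The threshold adds \<open>2 k\<close>, which makes the diameter of \<open>\<A> q t k n\<close> attained, to the value from
  which the negligible families in both cases of the upper bound sum up to at most \<open>N\<close>.
\<close>

theorem theorem7:
  fixes q k t :: nat
  assumes "q > 2" and "k > t"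
  shows "\<exists>n0. \<forall>n\<ge>n0.
           anticode q n (2 * (k - t) - 1) k (\<A> q t k n) \<and>
           (\<forall>B. anticode q n (2 * (k - t) - 1) k B \<longrightarrow> card B \<le> card (\<A> q t k n))"
proof (intro exI allI impI conjI)
  fix n assume n: "2 * k + (t + 2 + k * (2 ^ k * k + (q - 1) ^ (t + 1) * k) * (q - 1) ^ k) \<le> n"
  show "anticode q n (2 * (k - t) - 1) k (\<A> q t k n)"
    using assms by (rule anticode_\<A>) (use n in linarith)
  fix B assume "anticode q n (2 * (k - t) - 1) k B"
  then show "card B \<le> card (\<A> q t k n)"
    by (rule card_anticode_le[rotated 3]) (use assms n in linarith)+
qed

end
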